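(* Let $n_1,n_2\ge 0$ be integers, $N=n_1+n_2+2$, let $\mathcal X=\{x_j\}_{j=1}^m\subset\mathbb C$ be a set of $m\ge N$ distinct points and let $f:\mathcal X\to\mathbb C$. Let $\hat{\mathbf w}=[\hat w_1,\dots,\hat w_m]^T\in\mathcal S$ be a global maximizer of the dual function $d(\mathbf w)$ over the probability simplex $\mathcal S$, let $(\tilde p,\tilde q)\in\mathbb P_{n_1}\times\mathbb P_{n_2}$ be a minimizing pair in the definition of $d(\hat{\mathbf w})$, and let $\hat\xi=\hat p/\hat q$ be the irreducible representation of the rational function $\tilde p/\tilde q$. Put $\hat e=f-\hat\xi$ and $n=n_1+n_2-\upsilon(\hat p,\hat q)$. Suppose strong duality holds: $$\sqrt{d(\hat{\mathbf w})}=\|\hat e\|_{\infty,\mathcal X}=\max_{x\in\mathcal X}|f(x)-\hat\xi(x)| .$$ Then both of the following hold. (1) (Ruttan's sufficient condition) $\hat w_j=0$ whenever $x_j\notin\mathcal E(\hat\xi)$, and the Hermitian matrix $\sum_{j:\,x_j\in\mathcal E(\hat\xi)}\hat w_jH(x_j)\in\mathbb C^{N\times N}$ is positive semi-definite. (2) (Kolmogorov's dual condition) $$\sum_{j:\,x_j\in\mathcal E(\hat\xi)}\hat w_j\,\overline{\hat e(x_j)\hat q(x_j)}\,\frac{g(x_j)}{\hat q(x_j)}=0\qquad\text{for all } g\in\mathbb P_n .$$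
   Context: $\mathbb P_k$ is the space of complex polynomials of degree at most $k$. The probability simplex is $\mathcal S=\{\mathbf w\in\mathbb R^m:\ w_j\ge 0,\ \sum_{j=1}^m w_j=1\}$. The dual function is $$d(\mathbf w)=\min\left\{\sum_{j=1}^m w_j|f(x_j)q(x_j)-p(x_j)|^2:\ p\in\mathbb P_{n_1},\ q\in\mathbb P_{n_2},\ \sum_{j=1}^m w_j|q(x_j)|^2=1\right\}.$$ The defect of an irreducible $p/q$ (with $p\in\mathbb P_{n_1}$, $q\in\mathbb P_{n_2}$) is $\upsilon(p,q)=\min(n_1-\deg p,\ n_2-\deg q)$, with $\deg 0=-\infty$. The error of a rational function on $\mathcal X$ is infinite if it has a pole in $\mathcal X$; thus strong duality entails that $\hat q$ has no zeros in $\mathcal X$. The set of extreme points is $\mathcal E(\hat\xi)=\{x\in\mathcal X: |\hat e(x)|=\|\hat e\|_{\infty,\mathcal X}\}$. Fix bases $\psi_0,\dots,\psi_{n_1}$ of $\mathbb P_{n_1}$ and $\phi_0,\dots,\phi_{n_2}$ of $\mathbb P_{n_2}$ (definiteness does not depend on the choice). Define $$H(x)=\begin{bmatrix}H_1(x)&H_3(x)\\ H_3(x)^{\mathrm H}&H_2(x)\end{bmatrix}\in\mathbb C^{N\times N},$$ where $^{\mathrm H}$ is conjugate transpose and $[H_1(x)]_{\ell,k}=\overline{\psi_{\ell-1}(x)}\psi_{k-1}(x)$ for $1\le\ell,k\le n_1+1$; $[H_2(x)]_{\ell,k}=\left(|f(x)|^2-\|\hat e\|_{\infty,\mathcal X}^2\right)\overline{\phi_{\ell-1}(x)}\phi_{k-1}(x)$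 for $1\le\ell,k\le n_2+1$; $[H_3(x)]_{\ell,k}=-f(x)\overline{\psi_{\ell-1}(x)}\phi_{k-1}(x)$ for $1\le\ell\le n_1+1$, $1\le k\le n_2+1$. *)

theory Defs
  imports "Jordan_Normal_Form.Schur_Decomposition" "HOL-Library.Extended_Real"
begin

interpretation complex_poly: vector_space "smult :: complex \<Rightarrow> complex poly \<Rightarrow> complex poly"
  by unfold_locales (simp_all add: smult_add_right smult_add_left)

definition polys :: "nat \<Rightarrow> complex poly set" where
  "polys k = {p. degree p \<le> k}"

definition is_basis_polys :: "nat \<Rightarrow> (nat \<Rightarrow> complex poly) \<Rightarrow> bool" where
  "is_basis_polys k \<psi> \<longleftrightarrow>
     inj_on \<psi> {..k} \<and> complex_poly.independent (\<psi> ` {..k}) \<and>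
     complex_poly.span (\<psi> ` {..k}) = polys k"

definition prob_simplex :: "nat \<Rightarrow> real vec set" where
  "prob_simplex m =
     {w \<in> carrier_vec m. (\<forall>j<m. 0 \<le> w $ j) \<and> (\<Sum>j<m. w $ j) = 1}"

text \<open>Nodes and weights are numbered from 0: the nodes are \<open>x 0, \<dots>, x (m - 1)\<close>.\<close>

definition dual_feasible ::
  "nat \<Rightarrow> nat \<Rightarrow> nat \<Rightarrow> (nat \<Rightarrow> complex) \<Rightarrow> real vec \<Rightarrow> complex poly \<times> complex poly \<Rightarrow> bool" where
  "dual_feasible n1 n2 m x w = (\<lambda>(p, q).
     p \<in> polys n1 \<and> q \<in> polys n2 \<and> (\<Sum>j<m. w $ j * (cmod (poly q (x j)))\<^sup>2) = 1)"

definition dual_objective ::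
  "nat \<Rightarrow> (nat \<Rightarrow> complex) \<Rightarrow> (complex \<Rightarrow> complex) \<Rightarrow> real vec \<Rightarrow> complex poly \<times> complex poly \<Rightarrow> real" where
  "dual_objective m x f w = (\<lambda>(p, q).
     \<Sum>j<m. w $ j * (cmod (f (x j) * poly q (x j) - poly p (x j)))\<^sup>2)"

text \<open>On the probability simplex the feasible set is nonempty and the objective is nonnegative;
  the infimum is attained, because the values of \<open>p\<close> and \<open>q\<close> at the nodes of positive weight
  may be restricted to a compact subset of a finite-dimensional space.\<close>

definition dual_fun ::
  "nat \<Rightarrow> nat \<Rightarrow> nat \<Rightarrow> (nat \<Rightarrow> complex) \<Rightarrow> (complex \<Rightarrow> complex) \<Rightarrow> real vec \<Rightarrow> real" where
  "dual_fun n1 n2 m x f w = Inf (dual_objective m x f w ` Collect (dual_feasible n1 n2 m x w))"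

definition irreducible_rep ::
  "complex poly \<Rightarrow> complex poly \<Rightarrow> complex poly \<Rightarrow> complex poly \<Rightarrow> bool" where
  "irreducible_rep p' q' p q \<longleftrightarrow> q \<noteq> 0 \<and> coprime p q \<and> p' * q = p * q'"

text \<open>The case distinction implements the convention that the zero polynomial has degree
  \<open>-\<infinity>\<close>.\<close>

definition defect :: "nat \<Rightarrow> nat \<Rightarrow> complex poly \<Rightarrow> complex poly \<Rightarrow> nat" where
  "defect n1 n2 p q =
     (if p = 0 then n2 - degree q else min (n1 - degree p) (n2 - degree q))"

definition err :: "(complex \<Rightarrow> complex) \<Rightarrow> complex poly \<Rightarrow> complex poly \<Rightarrow> complex \<Rightarrow> complex" where
  "err f p q z = f z - poly p z / poly q z"

text \<open>For coprime \<open>p\<close> and \<open>q\<close> the zeros of \<open>q\<close> are exactly the poles of \<open>p / q\<close>,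
  where the error is infinite.\<close>

definition abs_err :: "(complex \<Rightarrow> complex) \<Rightarrow> complex poly \<Rightarrow> complex poly \<Rightarrow> complex \<Rightarrow> ereal" where
  "abs_err f p q z = (if poly q z = 0 then \<infinity> else ereal (cmod (err f p q z)))"

definition err_norm ::
  "complex set \<Rightarrow> (complex \<Rightarrow> complex) \<Rightarrow> complex poly \<Rightarrow> complex poly \<Rightarrow> ereal" where
  "err_norm X f p q = Max (abs_err f p q ` X)"

definition extreme_points ::
  "complex set \<Rightarrow> (complex \<Rightarrow> complex) \<Rightarrow> complex poly \<Rightarrow> complex poly \<Rightarrow> complex set" where
  "extreme_points X f p q = {z \<in> X. abs_err f p q z = err_norm X f p q}"

definition H1 :: "nat \<Rightarrow> (nat \<Rightarrow> complex poly) \<Rightarrow> complex \<Rightarrow> complex mat" where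
  "H1 n1 \<psi> z = mat (n1 + 1) (n1 + 1) (\<lambda>(l, k). cnj (poly (\<psi> l) z) * poly (\<psi> k) z)"

definition H2 ::
  "nat \<Rightarrow> (nat \<Rightarrow> complex poly) \<Rightarrow> (complex \<Rightarrow> complex) \<Rightarrow> real \<Rightarrow> complex \<Rightarrow> complex mat" where
  "H2 n2 \<phi> f \<eta> z = mat (n2 + 1) (n2 + 1)
     (\<lambda>(l, k). of_real ((cmod (f z))\<^sup>2 - \<eta>\<^sup>2) * cnj (poly (\<phi> l) z) * poly (\<phi> k) z)"

definition H3 ::
  "nat \<Rightarrow> nat \<Rightarrow> (nat \<Rightarrow> complex poly) \<Rightarrow> (nat \<Rightarrow> complex poly) \<Rightarrow> (complex \<Rightarrow> complex) \<Rightarrow>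
   complex \<Rightarrow> complex mat" where
  "H3 n1 n2 \<psi> \<phi> f z = mat (n1 + 1) (n2 + 1)
     (\<lambda>(l, k). - f z * cnj (poly (\<psi> l) z) * poly (\<phi> k) z)"

definition H ::
  "nat \<Rightarrow> nat \<Rightarrow> (nat \<Rightarrow> complex poly) \<Rightarrow> (nat \<Rightarrow> complex poly) \<Rightarrow> (complex \<Rightarrow> complex) \<Rightarrow>
   real \<Rightarrow> complex \<Rightarrow> complex mat" where
  "H n1 n2 \<psi> \<phi> f \<eta> z =
     four_block_mat (H1 n1 \<psi> z) (H3 n1 n2 \<psi> \<phi> f z)
       (mat_adjoint (H3 n1 n2 \<psi> \<phi> f z)) (H2 n2 \<phi> f \<eta> z)"

definition weighted_sum_mat ::
  "nat \<Rightarrow> nat set \<Rightarrow> real vec \<Rightarrow> (nat \<Rightarrow> complex mat) \<Rightarrow> complex mat" where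
  "weighted_sum_mat N J w A = mat N N (\<lambda>ij. \<Sum>j\<in>J. of_real (w $ j) * A j $$ ij)"

text \<open>In the order on the complex numbers used here, \<open>0 \<le> z\<close> means that \<open>z\<close> is real and
  nonnegative.\<close>

definition psd_hermitian_mat :: "nat \<Rightarrow> complex mat \<Rightarrow> bool" where
  "psd_hermitian_mat N A \<longleftrightarrow>
     A \<in> carrier_mat N N \<and> mat_adjoint A = A \<and>
     (\<forall>v \<in> carrier_vec N. 0 \<le> (A *\<^sub>v v) \<bullet>c v)"

end

theory Submission
  imports Defs "HOL-Computational_Algebra.Field_as_Ring" "HOL-Computational_Algebra.Polynomial_Factorial"
begin

text \<open>
  Write \<open>d = d(w)\<close>. By homogeneity, minimality of \<open>d\<close> says that the form
  \<open>F(P, Q) = \<Sum> w\<^sub>j (|f Q - P|\<^sup>2 - d |Q|\<^sup>2)(x\<^sub>j)\<close> is nonnegative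
  for all admissible \<open>P, Q\<close>, and \<open>\<Sum> w\<^sub>j H(x\<^sub>j)\<close> is its matrix. Strong duality bounds
  the error of \<open>p / q\<close> by \<open>sqrt d\<close> at every node, so \<open>F(p, q) \<le> 0\<close>; hence \<open>F(p, q) = 0\<close>,
  which forces \<open>w\<^sub>j = 0\<close> wherever the error is not extremal. Thus \<open>F\<close> is stationary at
  \<open>(p, q)\<close>, which is the orthogonality relation for all \<open>g = u q + v p\<close> with \<open>u, v\<close> of degree
  at most \<open>n1, n2\<close>; by Bezout these \<open>g\<close> are all the polynomials of degree at most \<open>n\<close>.
\<close>

section \<open>Bezout identities with degree control\<close>

text \<open>Multiplying a Bezout identity for 1 by \<open>g\<close> and reducing the cofactor of
  \<open>a\<close> modulo \<open>b\<close> bounds \<open>v\<close>; then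
  \<open>u * b = g - v * a\<close> bounds \<open>u\<close>. The parameter \<open>k\<close> is free
  so that numerator and denominator can exchange roles later.\<close>

lemma bezout_degree_bound:
  fixes a b g :: "complex poly"
  assumes cop: "coprime a b" and b: "b \<noteq> 0"
    and ka: "degree a \<le> k" and g: "degree g \<le> k + degree b"
  shows "\<exists>u v. g = u * b + v * a \<and> degree u \<le> k \<and> degree v \<le> degree b"
proof -
  obtain s t where st: "s * a + t * b = gcd a b"
    using bezout_coefficients_fst_snd by blast
  have one: "s * a + t * b = 1"
    using st cop by (simp add: coprime_iff_gcd_eq_1)
  define v where "v = (g * s) mod b"
  define u where "u = g * t + ((g * s) div b) * a"
  have gs: "g * s = (g * s) div b * b + v"
    unfolding v_def by simp
  have "u * b + v * a = g * (s * a + t * b)"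
    using arg_cong[OF gs, of "\<lambda>z. z * a"] unfolding u_def
    by (simp add: algebra_simps)
  then have eq: "g = u * b + v * a"
    using one by simp
  \<comment> \<open>If \<open>b\<close> is constant the remainder is zero, a case that the strict
    degree inequality alone would miss.\<close>
  have v: "v = 0 \<or> degree v < degree b"
    unfolding v_def using b by (rule degree_mod_less)
  have "degree (v * a) \<le> k + degree b"
    using v ka degree_mult_le[of v a] by auto
  then have "degree (u * b) \<le> k + degree b"
    using degree_diff_le[OF g, of "v * a"] eq by (metis add_diff_cancel_right')
  then have "degree u \<le> k"
    using b by (cases "u = 0") (auto simp: degree_mult_eq)
  moreover have "degree v \<le> degree b"
    using v by auto
  ultimately show ?thesis
    using eq by blast
qed

section \<open>First-order condition at a zero of a nonnegative Hermitian form\<close>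

text \<open>Along the line with parameter \<open>t\<close> the form is \<open>2 * Re (t * B)\<close>
  plus a multiple of the squared modulus of \<open>t\<close>. Nonnegativity for every complex
  \<open>t\<close> leaves no room for a linear term, so both real and imaginary part of
  \<open>B\<close> vanish.\<close>

lemma psd_form_stationary:
  fixes a b a' b' :: "'i \<Rightarrow> complex" and w :: "'i \<Rightarrow> real"
  assumes zero: "(\<Sum>j\<in>J. w j * ((cmod (a j))\<^sup>2 - c * (cmod (b j))\<^sup>2)) = 0"
    and nonneg: "\<And>t. 0 \<le> (\<Sum>j\<in>J. w j * ((cmod (a j + t * a' j))\<^sup>2 - c * (cmod (b j + t * b' j))\<^sup>2))"
  shows "(\<Sum>j\<in>J. w j * (cnj (a j) * a' j - c * (cnj (b j) * b' j))) = 0" (is "?B = 0")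
proof -
  define F where "F = (\<Sum>j\<in>J. w j * ((cmod (a' j))\<^sup>2 - c * (cmod (b' j))\<^sup>2))"
  have sq: "(cmod (y + t * z))\<^sup>2 = (cmod y)\<^sup>2 + 2 * Re (t * (cnj y * z)) + (cmod t)\<^sup>2 * (cmod z)\<^sup>2" for y z t
    by (simp only: cmod_power2, simp) (simp add: algebra_simps power2_eq_square)
  have exp: "w j * ((cmod (a j + t * a' j))\<^sup>2 - c * (cmod (b j + t * b' j))\<^sup>2) =
      w j * ((cmod (a j))\<^sup>2 - c * (cmod (b j))\<^sup>2)
      + 2 * Re (t * (w j * (cnj (a j) * a' j - c * (cnj (b j) * b' j))))
      + (cmod t)\<^sup>2 * (w j * ((cmod (a' j))\<^sup>2 - c * (cmod (b' j))\<^sup>2))" for t j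
    unfolding sq by (simp add: algebra_simps)
  have "0 \<le> 2 * Re (t * ?B) + (cmod t)\<^sup>2 * F" for t
  proof -
    have "0 \<le> (\<Sum>j\<in>J. w j * ((cmod (a j))\<^sup>2 - c * (cmod (b j))\<^sup>2)
      + 2 * Re (t * (w j * (cnj (a j) * a' j - c * (cnj (b j) * b' j))))
      + (cmod t)\<^sup>2 * (w j * ((cmod (a' j))\<^sup>2 - c * (cmod (b' j))\<^sup>2)))"
      using nonneg[of t] unfolding exp .
    also have "\<dots> = 2 * Re (t * ?B) + (cmod t)\<^sup>2 * F"
      unfolding F_def sum.distrib zero sum_distrib_left[symmetric] Re_sum[symmetric] by simp
    finally show ?thesis .
  qed
  note ineq = this
  \<comment> \<open>At \<open>t = - s * cnj B\<close> the form equals \<open>(s * F - 2) * s\<close>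
    times the squared modulus of \<open>B\<close>. The choice of \<open>s\<close> makes the first
    factor negative, whatever the sign of \<open>F\<close>.\<close>
  define s where "s = 1 / (1 + \<bar>F\<bar>)"
  have s: "0 < s" "s * F < 1"
    unfolding s_def by (auto simp: field_simps) 
  have "0 \<le> 2 * Re (- (s * cnj ?B) * ?B) + (cmod (- (s * cnj ?B)))\<^sup>2 * F"
    by (rule ineq)
  also have "Re (- (s * cnj ?B) * ?B) = - (s * (cmod ?B)\<^sup>2)"
  proof -
    have "Re (- (s * cnj z) * z) = - (s * (cmod z)\<^sup>2)" for z
      by (simp add: cmod_power2) (simp add: algebra_simps power2_eq_square)
    then show ?thesis .
  qed
  also have "(cmod (- (s * cnj ?B)))\<^sup>2 = s\<^sup>2 * (cmod ?B)\<^sup>2"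
    by (simp only: norm_minus_cancel norm_mult complex_mod_cnj) (simp add: power_mult_distrib)
  also have "2 * - (s * (cmod ?B)\<^sup>2) + s\<^sup>2 * (cmod ?B)\<^sup>2 * F = (s * F - 2) * (s * (cmod ?B)\<^sup>2)"
    by (simp add: algebra_simps power2_eq_square)
  finally have "s * (cmod ?B)\<^sup>2 \<le> 0"
    using s by (simp add: zero_le_mult_iff)
  then have "(cmod ?B)\<^sup>2 \<le> 0"
    using s(1) by (simp add: mult_le_0_iff)
  then show ?thesis
    by simp
qed

section \<open>The dual function as a homogeneous quadratic inequality\<close>

lemma dual_fun_eq_minimum:
  assumes "is_arg_min (dual_objective m x f w) (dual_feasible n1 n2 m x w) pq"
  shows "dual_fun n1 n2 m x f w = dual_objective m x f w pq"
  unfolding dual_fun_def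
  using assms by (intro cInf_eq_minimum) (auto simp: is_arg_min_linorder)

text \<open>Residual and denominator sums scale alike under a common factor of \<open>P\<close> and
  \<open>Q\<close>, so a lower bound on normalised pairs extends to all pairs.\<close>

lemma dual_objective_homogeneous:
  assumes w: "\<And>j. j < m \<Longrightarrow> 0 \<le> w $ j"
    and min: "\<And>pq. dual_feasible n1 n2 m x w pq \<Longrightarrow> d \<le> dual_objective m x f w pq"
    and P: "P \<in> polys n1" and Q: "Q \<in> polys n2"
  shows "0 \<le> (\<Sum>j<m. w $ j * ((cmod (f (x j) * poly Q (x j) - poly P (x j)))\<^sup>2
                 - d * (cmod (poly Q (x j)))\<^sup>2))"
proof -
  define S where "S = (\<Sum>j<m. w $ j * (cmod (poly Q (x j)))\<^sup>2)"
  define D where "D = dual_objective m x f w (P, Q)"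
  have S0: "0 \<le> S" and D0: "0 \<le> D"
    unfolding S_def D_def dual_objective_def prod.case using w by (auto intro!: sum_nonneg)
  have eq: "(\<Sum>j<m. w $ j * ((cmod (f (x j) * poly Q (x j) - poly P (x j)))\<^sup>2
                 - d * (cmod (poly Q (x j)))\<^sup>2)) = D - d * S"
    unfolding S_def D_def dual_objective_def prod.case
    by (simp add: sum_distrib_left sum_subtractf algebra_simps)
  show ?thesis
  proof (cases "S = 0")
    \<comment> \<open>Such a pair cannot be normalised, but the form reduces to the nonnegative
      residual sum.\<close>
    case True
    then show ?thesis using eq D0 by simp
  next
    case False
    define r where "r = 1 / sqrt S"
    have r2: "r\<^sup>2 = 1 / S"
      using S0 by (simp add: r_def power_divide)
    have "dual_feasible n1 n2 m x w (smult r P, smult r Q)"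
    proof -
      have "(\<Sum>j<m. w $ j * (cmod (poly (smult r Q) (x j)))\<^sup>2) = r\<^sup>2 * S"
        unfolding S_def sum_distrib_left
        by (intro sum.cong) (simp_all add: norm_mult power_mult_distrib)
      also have "\<dots> = 1"
        using False by (simp add: r2)
      finally show ?thesis
        using P Q by (auto simp: dual_feasible_def polys_def)
    qed
    then have "d \<le> dual_objective m x f w (smult r P, smult r Q)"
      by (rule min)
    also have "\<dots> = r\<^sup>2 * D"
    proof -
      have "f z * (of_real r * u) - of_real r * v = of_real r * (f z * u - v)" for z u v :: complex
        by (simp add: algebra_simps)
      then have "(cmod (f z * (of_real r * u) - of_real r * v))\<^sup>2 = r\<^sup>2 * (cmod (f z * u - v))\<^sup>2" for z u v :: complex
        by (simp add: norm_mult power_mult_distrib)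
      then show ?thesis
        unfolding D_def dual_objective_def prod.case poly_smult sum_distrib_left
        by (intro sum.cong) simp_all
    qed
    finally show ?thesis
      unfolding eq r2 using S0 False by (simp add: field_simps)
  qed
qed

section \<open>Coordinates and the matrix of the form\<close>

lemma basis_poly_in_polys:
  assumes "is_basis_polys k \<psi>" and "i \<le> k"
  shows "\<psi> i \<in> polys k"
  using assms complex_poly.span_base[of "\<psi> i" "\<psi> ` {..k}"] by (auto simp: is_basis_polys_def)

lemma sum_smult_in_polys:
  assumes "\<And>i. i \<in> I \<Longrightarrow> \<psi> i \<in> polys k"
  shows "(\<Sum>i\<in>I. smult (c i) (\<psi> i)) \<in> polys k"
  using assms unfolding polys_def
  by (induction I rule: infinite_finite_induct) (auto intro!: degree_add_le)

text \<open>Each \<open>A j\<close> is a difference of two rank-one Hermitian matrices, so its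
  quadratic form is a difference of squared moduli of linear functionals. Here \<open>\<eta>\<close>
  takes the place of the squared error norm.\<close>

lemma psd_weighted_outer_products:
  fixes b c :: "nat \<Rightarrow> nat \<Rightarrow> complex" and w :: "real vec" and \<eta> :: real
  assumes entry: "\<And>j l k. j \<in> J \<Longrightarrow> l < N \<Longrightarrow> k < N \<Longrightarrow>
      A j $$ (l, k) = cnj (b j l) * b j k - \<eta> * (cnj (c j l) * c j k)"
    and nonneg: "\<And>v. 0 \<le> (\<Sum>j\<in>J. w $ j * ((cmod (\<Sum>k<N. b j k * v k))\<^sup>2
                       - \<eta> * (cmod (\<Sum>k<N. c j k * v k))\<^sup>2))"
  shows "psd_hermitian_mat N (weighted_sum_mat N J w A)"
proof -
  let ?M = "weighted_sum_mat N J w A"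
  have M: "?M \<in> carrier_mat N N"
    by (simp add: weighted_sum_mat_def)
  have M_entry: "?M $$ (l, k) = (\<Sum>j\<in>J. w $ j * (cnj (b j l) * b j k - \<eta> * (cnj (c j l) * c j k)))"
    if "l < N" "k < N" for l k
    using that entry by (simp add: weighted_sum_mat_def)
  have "mat_adjoint ?M = ?M"
  proof (rule eq_matI)
    fix i j assume "i < dim_row ?M" "j < dim_col ?M"
    then have "i < N" "j < N" using M by auto
    then show "mat_adjoint ?M $$ (i, j) = ?M $$ (i, j)"
      using M by (simp add: mat_adjoint_def mat_of_rows_def M_entry mult.commute)
  qed (use M in \<open>auto simp: mat_adjoint_def\<close>)
  moreover have "0 \<le> (?M *\<^sub>v v) \<bullet>c v" if v: "v \<in> carrier_vec N" for v
  proof -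
    \<comment> \<open>The double sum is the product of a linear functional of \<open>v\<close> and
      its conjugate.\<close>
    have sq: "(\<Sum>l<N. \<Sum>k<N. cnj (g l) * g k * v $ k * cnj (v $ l)) = (cmod (\<Sum>k<N. g k * v $ k))\<^sup>2" for g
    proof -
      have "(\<Sum>l<N. \<Sum>k<N. cnj (g l) * g k * v $ k * cnj (v $ l)) = (\<Sum>l<N. cnj (g l * v $ l)) * (\<Sum>k<N. g k * v $ k)"
        by (subst mult.commute) (subst sum_product, subst sum.swap, simp add: ac_simps)
      also have "\<dots> = (cmod (\<Sum>k<N. g k * v $ k))\<^sup>2"
        unfolding cnj_sum[symmetric] by (subst mult.commute) (rule complex_norm_square[symmetric])
      finally show ?thesis .
    qed
    have "(?M *\<^sub>v v) \<bullet>c v = (\<Sum>l<N. (\<Sum>k<N. ?M $$ (l, k) * v $ k) * cnj (v $ l))"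
      using M v by (auto simp: scalar_prod_def lessThan_atLeast0 intro!: sum.cong)
    also have "\<dots> = (\<Sum>l<N. \<Sum>k<N. \<Sum>j\<in>J. w $ j * (cnj (b j l) * b j k * v $ k * cnj (v $ l)
                    - \<eta> * (cnj (c j l) * c j k * v $ k * cnj (v $ l))))"
      by (simp only: sum_distrib_right, intro sum.cong refl, subst M_entry)
        (simp_all add: sum_distrib_right mult.assoc left_diff_distrib)
    also have "\<dots> = (\<Sum>l<N. \<Sum>j\<in>J. \<Sum>k<N. w $ j * (cnj (b j l) * b j k * v $ k * cnj (v $ l)
                    - \<eta> * (cnj (c j l) * c j k * v $ k * cnj (v $ l))))"
      by (intro sum.cong refl sum.swap)
    also have "\<dots> = (\<Sum>j\<in>J. \<Sum>l<N. \<Sum>k<N. w $ j * (cnj (b j l) * b j k * v $ k * cnj (v $ l)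
                    - \<eta> * (cnj (c j l) * c j k * v $ k * cnj (v $ l))))"
      by (rule sum.swap)
    also have "\<dots> = (\<Sum>j\<in>J. w $ j * (((cmod (\<Sum>k<N. b j k * v $ k))\<^sup>2
                       - \<eta> * (cmod (\<Sum>k<N. c j k * v $ k))\<^sup>2)))"
      unfolding sum_distrib_left[symmetric] sum_subtractf sq by simp
    finally have "(?M *\<^sub>v v) \<bullet>c v = of_real (\<Sum>j\<in>J. w $ j * (((cmod (\<Sum>k<N. b j k * v $ k))\<^sup>2
                       - \<eta> * (cmod (\<Sum>k<N. c j k * v $ k))\<^sup>2)))" .
    then show ?thesis
      using nonneg[of "\<lambda>k. v $ k"]
      by (simp only: less_eq_complex_def Re_complex_of_real Im_complex_of_real zero_complex.sel)
  qed
  ultimately show ?thesis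
    using M by (simp add: psd_hermitian_mat_def)
qed

text \<open>Row vector of the functional sending \<open>(P, Q)\<close> to the residual
  \<open>f Q - P\<close> at \<open>z\<close>; numerator coordinates come first, so the denominator
  block starts at \<open>n1 + 1\<close>.\<close>

definition residual_coeff ::
  "nat \<Rightarrow> (nat \<Rightarrow> complex poly) \<Rightarrow> (nat \<Rightarrow> complex poly) \<Rightarrow> (complex \<Rightarrow> complex) \<Rightarrow> complex \<Rightarrow> nat \<Rightarrow> complex"
  where "residual_coeff n1 \<psi> \<phi> f z k =
     (if k < n1 + 1 then - poly (\<psi> k) z else f z * poly (\<phi> (k - (n1 + 1))) z)"

text \<open>Row vector of the functional sending \<open>(P, Q)\<close> to the value of
  \<open>Q\<close> at \<open>z\<close>, in the same coordinates.\<close>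

definition denominator_coeff :: "nat \<Rightarrow> (nat \<Rightarrow> complex poly) \<Rightarrow> complex \<Rightarrow> nat \<Rightarrow> complex"
  where "denominator_coeff n1 \<phi> z k = (if k < n1 + 1 then 0 else poly (\<phi> (k - (n1 + 1))) z)"

text \<open>The four blocks assemble into the outer product of the residual functional minus
  \<open>\<eta>\<^sup>2\<close> times that of the denominator functional.\<close>

lemma H_entry:
  assumes "l < n1 + n2 + 2" "k < n1 + n2 + 2"
  shows "H n1 n2 \<psi> \<phi> f \<eta> z $$ (l, k) =
     cnj (residual_coeff n1 \<psi> \<phi> f z l) * residual_coeff n1 \<psi> \<phi> f z k
     - \<eta>\<^sup>2 * (cnj (denominator_coeff n1 \<phi> z l) * denominator_coeff n1 \<phi> z k)"
proof -
  have "complex_of_real ((cmod (f z))\<^sup>2) = f z * cnj (f z)"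
    by (rule complex_norm_square)
  then show ?thesis
    using assms
    by (auto simp: H_def H1_def H2_def H3_def mat_adjoint_def mat_of_rows_def
        residual_coeff_def denominator_coeff_def algebra_simps)
qed

lemma sum_split_blocks:
  fixes g :: "nat \<Rightarrow> complex"
  shows "(\<Sum>k<n1 + n2 + 2. g k) = (\<Sum>k\<le>n1. g k) + (\<Sum>k\<le>n2. g (n1 + 1 + k))"
  by (induction n2) (simp_all add: lessThan_Suc_atMost[symmetric])

section \<open>The defect and degrees of the irreducible representation\<close>

text \<open>For nonzero \<open>p\<close> the degree bound is the larger of
  \<open>n1 + degree q\<close> and \<open>n2 + degree p\<close>, and each of these is within reach
  of one of the two Bezout reductions.\<close>

lemma polys_eq_bezout_combination:
  assumes cop: "coprime p q" and q: "q \<noteq> 0" "q \<in> polys n2" and p: "p \<in> polys n1"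
    and g: "g \<in> polys (n1 + n2 - defect n1 n2 p q)"
  shows "\<exists>u\<in>polys n1. \<exists>v\<in>polys n2. g = u * q + v * p"
proof (cases "p = 0")
  case True
  \<comment> \<open>Coprimality with 0 makes \<open>q\<close> a unit, so the defect is
    \<open>n2\<close> and the bound on \<open>g\<close> is \<open>n1\<close>.\<close>
  then have "degree q = 0"
    using cop by (simp add: is_unit_iff_degree q)
  then have "degree g \<le> n1 + degree q" "degree p \<le> n1"
    using g True by (auto simp: polys_def defect_def)
  from bezout_degree_bound[OF cop q(1) this(2,1)] obtain u v where
    "g = u * q + v * p" "u \<in> polys n1" "degree v \<le> degree q"
    by (auto simp: polys_def)
  moreover have "v \<in> polys n2"
    using calculation(3) q(2) by (simp add: polys_def)
  ultimately show ?thesis by blast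
next
  case False
  then consider "degree g \<le> n1 + degree q" | "degree g \<le> n2 + degree p"
    using g p q by (auto simp: polys_def defect_def min_def split: if_splits)
  then show ?thesis
  proof cases
    case 1
    from bezout_degree_bound[OF cop q(1) _ this] p obtain u v where
      "g = u * q + v * p" "u \<in> polys n1" "degree v \<le> degree q"
      by (auto simp: polys_def)
    moreover have "v \<in> polys n2"
      using calculation(3) q(2) by (simp add: polys_def)
    ultimately show ?thesis by blast
  next
    case 2
    \<comment> \<open>Now the cofactor of \<open>q\<close> is reduced modulo \<open>p\<close>, which
      keeps its degree at most \<open>n1\<close>.\<close>
    from bezout_degree_bound[OF _ False _ this, of q] obtain u v where
      "g = u * p + v * q" "degree u \<le> n2" "degree v \<le> degree p"
      using cop q by (auto simp: polys_def coprime_commute)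
    then have "g = v * q + u * p" "v \<in> polys n1" "u \<in> polys n2"
      using p by (auto simp: polys_def)
    then show ?thesis by blast
  qed
qed

text \<open>Coprimality gives \<open>q dvd q'\<close>, and the same quotient divides
  \<open>p'\<close>: passing to the irreducible pair only cancels a common factor.\<close>

lemma irreducible_rep_polys:
  assumes irr: "irreducible_rep p' q' p q" and q': "q' \<noteq> 0"
    and "p' \<in> polys n1" "q' \<in> polys n2"
  shows "p \<in> polys n1" and "q \<in> polys n2"
proof -
  have cop: "coprime p q" and q: "q \<noteq> 0" and eq: "p' * q = p * q'"
    using irr by (auto simp: irreducible_rep_def)
  have "q dvd p * q'"
    using eq by (metis dvd_triv_right)
  then have "q dvd q'"
    using cop by (simp add: coprime_dvd_mult_right_iff coprime_commute)
  then obtain r where r: "q' = q * r" ..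
  then have "p' = p * r"
    using eq q by (auto simp: ac_simps)
  with r q' q have "degree p \<le> degree p' \<or> p = 0" "degree q \<le> degree q'"
    by (cases "p = 0"; simp add: degree_mult_eq)+
  then show "p \<in> polys n1" and "q \<in> polys n2"
    using assms(3,4) by (auto simp: polys_def)
qed

text \<open>A pole at a node would make the maximum infinite, so a real value of the norm excludes
  zeros of \<open>q\<close> on \<open>X\<close>.\<close>

lemma err_norm_finite_bound:
  assumes X: "finite X" and fin: "err_norm X f p q = ereal \<eta>" and z: "z \<in> X"
  shows "poly q z \<noteq> 0" and "cmod (err f p q z) \<le> \<eta>"
    and "z \<in> extreme_points X f p q \<longleftrightarrow> cmod (err f p q z) = \<eta>"
proof -
  have "abs_err f p q z \<le> ereal \<eta>"
    unfolding fin[symmetric] err_norm_def using X z by simp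
  then show *: "poly q z \<noteq> 0" and "cmod (err f p q z) \<le> \<eta>"
    by (auto simp: abs_err_def split: if_splits)
  show "z \<in> extreme_points X f p q \<longleftrightarrow> cmod (err f p q z) = \<eta>"
    using z fin * by (auto simp: extreme_points_def abs_err_def)
qed

theorem mainTheorem5:
  fixes n1 n2 N m n :: nat
    and x :: "nat \<Rightarrow> complex" and X E :: "complex set" and f :: "complex \<Rightarrow> complex"
    and w :: "real vec" and p' q' p q :: "complex poly"
    and \<psi> \<phi> :: "nat \<Rightarrow> complex poly"
  defines "N \<equiv> n1 + n2 + 2"
    and "X \<equiv> x ` {..<m}"
    and "n \<equiv> n1 + n2 - defect n1 n2 p q"
    and "E \<equiv> extreme_points X f p q"
  assumes m: "m \<ge> N"
    and distinct_nodes: "inj_on x {..<m}"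
    and basis_\<psi>: "is_basis_polys n1 \<psi>"
    and basis_\<phi>: "is_basis_polys n2 \<phi>"
    and maximizer: "is_arg_max (dual_fun n1 n2 m x f) (\<lambda>v. v \<in> prob_simplex m) w"
    and minimizing_pair:
      "is_arg_min (dual_objective m x f w) (dual_feasible n1 n2 m x w) (p', q')"
    and irreducible_pq: "irreducible_rep p' q' p q"
    and strong_duality: "ereal (sqrt (dual_fun n1 n2 m x f w)) = err_norm X f p q"
  shows "((\<forall>j<m. x j \<notin> E \<longrightarrow> w $ j = 0) \<and>
          psd_hermitian_mat N
            (weighted_sum_mat N {j. j < m \<and> x j \<in> E} w
              (\<lambda>j. H n1 n2 \<psi> \<phi> f (real_of_ereal (err_norm X f p q)) (x j)))) \<and>
         (\<forall>g \<in> polys n.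
            (\<Sum>j | j < m \<and> x j \<in> E.
               of_real (w $ j) * cnj (err f p q (x j) * poly q (x j)) *
                 (poly g (x j) / poly q (x j))) = 0)"
proof -

  \<comment> \<open>Equality in the dual inequality and complementary slackness\<close>
  define d where "d = dual_fun n1 n2 m x f w"
  define \<eta> where "\<eta> = sqrt d"
  have w: "0 \<le> w $ j" if "j < m" for j
    using maximizer that by (auto simp: is_arg_max_def prob_simplex_def)
  have d_eq: "d = dual_objective m x f w (p', q')"
    unfolding d_def using minimizing_pair by (rule dual_fun_eq_minimum)
  have d_min: "d \<le> dual_objective m x f w pq" if "dual_feasible n1 n2 m x w pq" for pq
    unfolding d_eq using minimizing_pair that unfolding is_arg_min_linorder by blast
  have "0 \<le> d"
    unfolding d_eq dual_objective_def prod.case using w by (auto intro!: sum_nonneg)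
  then have \<eta>2: "\<eta>\<^sup>2 = d" and \<eta>0: "0 \<le> \<eta>"
    by (auto simp: \<eta>_def)
  have norm_eq: "err_norm X f p q = ereal \<eta>"
    using strong_duality by (simp add: \<eta>_def d_def)
  have "dual_feasible n1 n2 m x w (p', q')"
    using minimizing_pair by (simp add: is_arg_min_def)
  \<comment> \<open>A zero denominator would contradict the normalisation to 1.\<close>
  then have p'q': "p' \<in> polys n1" "q' \<in> polys n2" "q' \<noteq> 0"
    by (auto simp: dual_feasible_def)
  note pq = irreducible_rep_polys[OF irreducible_pq p'q'(3,1,2)]
  have q0: "q \<noteq> 0" and cop: "coprime p q"
    using irreducible_pq by (auto simp: irreducible_rep_def)
  have "finite X"
    by (simp add: X_def)
  note bound = err_norm_finite_bound[OF this norm_eq, folded E_def]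
  have qx: "poly q (x j) \<noteq> 0" and ex: "cmod (err f p q (x j)) \<le> \<eta>"
    and E_iff: "x j \<in> E \<longleftrightarrow> cmod (err f p q (x j)) = \<eta>" if "j < m" for j
    using bound that by (auto simp: X_def)
  have nonneg: "0 \<le> (\<Sum>j<m. w $ j * ((cmod (f (x j) * poly Q (x j) - poly P (x j)))\<^sup>2
                 - d * (cmod (poly Q (x j)))\<^sup>2))"
    if "P \<in> polys n1" "Q \<in> polys n2" for P Q
    by (rule dual_objective_homogeneous[OF w d_min that])
  have res: "f (x j) * poly q (x j) - poly p (x j) = err f p q (x j) * poly q (x j)"
    if "j < m" for j
    using qx[OF that] by (simp add: err_def field_simps)
  have term_eq: "w $ j * ((cmod (f (x j) * poly q (x j) - poly p (x j)))\<^sup>2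
                 - d * (cmod (poly q (x j)))\<^sup>2)
      = - (w $ j * (\<eta>\<^sup>2 - (cmod (err f p q (x j)))\<^sup>2) * (cmod (poly q (x j)))\<^sup>2)" if "j < m" for j
    unfolding res[OF that] \<eta>2 by (simp add: norm_mult power_mult_distrib algebra_simps)
  have gap: "0 \<le> w $ j * (\<eta>\<^sup>2 - (cmod (err f p q (x j)))\<^sup>2) * (cmod (poly q (x j)))\<^sup>2"
    if "j < m" for j
    using w[OF that] power_mono[OF ex[OF that], of 2] by simp
  \<comment> \<open>The reduced pair, not only \<open>(p', q')\<close>, attains equality; unlike \<open>q'\<close>, its denominator
    vanishes at no node.\<close>
  have "(\<Sum>j<m. w $ j * (\<eta>\<^sup>2 - (cmod (err f p q (x j)))\<^sup>2) * (cmod (poly q (x j)))\<^sup>2) \<le> 0"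
    using nonneg[OF pq] by (simp add: term_eq sum_negf)
  then have sum0: "(\<Sum>j<m. w $ j * (\<eta>\<^sup>2 - (cmod (err f p q (x j)))\<^sup>2) * (cmod (poly q (x j)))\<^sup>2) = 0"
    using gap by (intro antisym sum_nonneg) auto
  \<comment> \<open>Every summand of a vanishing sum of nonnegative terms is zero; off
    \<open>E\<close> the error gap and \<open>q\<close> are nonzero, which leaves only the
    weight.\<close>
  have w0: "w $ j = 0" if j: "j < m" and "x j \<notin> E" for j
  proof -
    have "w $ j * (\<eta>\<^sup>2 - (cmod (err f p q (x j)))\<^sup>2) * (cmod (poly q (x j)))\<^sup>2 = 0"
      using sum0 gap j by (subst (asm) sum_nonneg_eq_0_iff) auto
    moreover have "\<eta>\<^sup>2 \<noteq> (cmod (err f p q (x j)))\<^sup>2"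
      using that E_iff[OF j] \<eta>0 by (simp add: power2_eq_iff_nonneg)
    ultimately show ?thesis
      using qx[OF j] by simp
  qed
  let ?J = "{j. j < m \<and> x j \<in> E}"
  \<comment> \<open>Since the weights vanish off \<open>E\<close>, weighted sums over extreme points
    and over all nodes agree.\<close>
  have sum_J: "(\<Sum>j\<in>?J. h j) = (\<Sum>j<m. h j)" if "\<And>j. w $ j = 0 \<Longrightarrow> h j = 0"
    for h :: "nat \<Rightarrow> 'z::comm_monoid_add"
    using w0 that by (intro sum.mono_neutral_left) auto

  \<comment> \<open>Ruttan's sufficient condition\<close>
  have "psd_hermitian_mat N
            (weighted_sum_mat N ?J w (\<lambda>j. H n1 n2 \<psi> \<phi> f \<eta> (x j)))"
  proof (rule psd_weighted_outer_products)
    fix j l k assume "l < N" "k < N"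
    then show "H n1 n2 \<psi> \<phi> f \<eta> (x j) $$ (l, k) =
        cnj (residual_coeff n1 \<psi> \<phi> f (x j) l) * residual_coeff n1 \<psi> \<phi> f (x j) k
        - complex_of_real (\<eta>\<^sup>2) * (cnj (denominator_coeff n1 \<phi> (x j) l) * denominator_coeff n1 \<phi> (x j) k)"
      unfolding N_def by (subst H_entry) simp_all
  next
    fix v :: "nat \<Rightarrow> complex"
    \<comment> \<open>A coordinate vector encodes a pair of polynomials, and the quadratic form of
      the matrix is the dual form at that pair.\<close>
    define P where "P = (\<Sum>k\<le>n1. smult (v k) (\<psi> k))"
    define Q where "Q = (\<Sum>k\<le>n2. smult (v (n1 + 1 + k)) (\<phi> k))"
    have P: "P \<in> polys n1" and Q: "Q \<in> polys n2"
      unfolding P_def Q_def using basis_\<psi> basis_\<phi>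
      by (auto intro!: sum_smult_in_polys basis_poly_in_polys)
    have "(\<Sum>k<N. residual_coeff n1 \<psi> \<phi> f z k * v k) = f z * poly Q z - poly P z" for z
      unfolding N_def sum_split_blocks
      by (simp add: residual_coeff_def P_def Q_def poly_sum sum_distrib_left sum_negf ac_simps)
    moreover have "(\<Sum>k<N. denominator_coeff n1 \<phi> z k * v k) = poly Q z" for z
      unfolding N_def sum_split_blocks
      by (simp add: denominator_coeff_def Q_def poly_sum ac_simps)
    ultimately show "0 \<le> (\<Sum>j\<in>?J. w $ j *
        ((cmod (\<Sum>k<N. residual_coeff n1 \<psi> \<phi> f (x j) k * v k))\<^sup>2
         - \<eta>\<^sup>2 * (cmod (\<Sum>k<N. denominator_coeff n1 \<phi> (x j) k * v k))\<^sup>2))"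
      using nonneg[OF P Q] by (subst sum_J) (simp_all add: \<eta>2)
  qed

  \<comment> \<open>Kolmogorov's dual condition\<close>
  moreover have "(\<Sum>j\<in>?J. of_real (w $ j) * cnj (err f p q (x j) * poly q (x j)) *
                 (poly g (x j) / poly q (x j))) = 0" if g: "g \<in> polys n" for g
  proof -
    obtain u v where u: "u \<in> polys n1" and v: "v \<in> polys n2" and guv: "g = u * q + v * p"
      using polys_eq_bezout_combination[OF cop q0 pq(2,1)] g unfolding n_def by blast
    have "(\<Sum>j<m. w $ j * ((cmod (f (x j) * poly q (x j) - poly p (x j)))\<^sup>2
                 - d * (cmod (poly q (x j)))\<^sup>2)) = 0"
      using sum0 by (simp add: term_eq sum_negf)
    \<comment> \<open>Stationarity at \<open>(p, q)\<close> in the direction \<open>(- u, v)\<close>.\<close>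
    then have "(\<Sum>j<m. w $ j * (cnj (f (x j) * poly q (x j) - poly p (x j)) *
        (f (x j) * poly v (x j) + poly u (x j)) - d * (cnj (poly q (x j)) * poly v (x j)))) = 0"
    proof (rule psd_form_stationary)
      fix t
      have "p - smult t u \<in> polys n1" "q + smult t v \<in> polys n2"
        using pq u v by (auto simp: polys_def intro!: degree_diff_le degree_add_le)
      from nonneg[OF this] show "0 \<le> (\<Sum>j<m. w $ j *
          ((cmod (f (x j) * poly q (x j) - poly p (x j) + t * (f (x j) * poly v (x j) + poly u (x j))))\<^sup>2
           - d * (cmod (poly q (x j) + t * poly v (x j)))\<^sup>2))"
        by (simp add: algebra_simps)
    qed
    also have "(\<Sum>j<m. w $ j * (cnj (f (x j) * poly q (x j) - poly p (x j)) *
        (f (x j) * poly v (x j) + poly u (x j)) - d * (cnj (poly q (x j)) * poly v (x j))))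
      = (\<Sum>j<m. of_real (w $ j) * cnj (err f p q (x j) * poly q (x j)) *
                 (poly g (x j) / poly q (x j)))"
    proof (rule sum.cong[OF refl], goal_cases)
      case (1 j)
      then have j: "j < m" by simp
      let ?e = "err f p q (x j)"
      \<comment> \<open>With \<open>d\<close> written as \<open>cnj e * e\<close> at an extreme
        point, \<open>cnj (e * B)\<close> factors out of both terms; at other nodes the weight is
        zero.\<close>
      have factor: "W * (cnj (e * B) * (F * V + U) - (cnj e * e) * (cnj B * V))
          = W * cnj (e * B) * ((F - e) * V + U)" for W e B F V U :: complex
        by (simp add: algebra_simps)
      have "w $ j * (cnj (?e * poly q (x j)) * (f (x j) * poly v (x j) + poly u (x j))
            - d * (cnj (poly q (x j)) * poly v (x j)))
          = w $ j * cnj (?e * poly q (x j)) * ((f (x j) - ?e) * poly v (x j) + poly u (x j))"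
      proof (cases "x j \<in> E")
        case True
        then have "d = (cmod ?e)\<^sup>2"
          using E_iff[OF j] \<eta>2 by simp
        then have "complex_of_real d = cnj ?e * ?e"
          using complex_norm_square[of ?e] by (simp only: mult.commute)
        then show ?thesis
          by (simp only: factor)
      next
        case False
        then show ?thesis
          using w0[OF j] by simp
      qed
      \<comment> \<open>Because \<open>f - e = p / q\<close>, the remaining factor is
        \<open>(p v + q u) / q\<close>.\<close>
      also have "(f (x j) - ?e) * poly v (x j) + poly u (x j) = poly g (x j) / poly q (x j)"
        using qx[OF j] by (simp add: err_def guv add_divide_distrib mult.commute)
      finally show ?case
        unfolding res[OF j] .
    qed
    also have "\<dots> = (\<Sum>j\<in>?J. of_real (w $ j) * cnj (err f p q (x j) * poly q (x j)) *
                 (poly g (x j) / poly q (x j)))"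
      by (rule sum_J[symmetric]) simp
    finally show ?thesis .
  qed
  ultimately show ?thesis
    using w0 by (simp add: norm_eq)
qed

end
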